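(* There exist $n\in\mathbb{N}$, $L>0$, a nonempty compact convex set $\mathcal{C}\subset\mathbb{R}^n$, an open convex set $\mathcal{D}\subset\mathbb{R}^n$ containing $\mathcal{C}$, a convex function $f\colon\mathcal{D}\to\mathbb{R}$ with $L$-Lipschitz-continuous gradient such that $\operatorname{arg\,min}_{\mathcal{C}}f\subset\operatorname{int}\mathcal{C}$, and a point $x_0\in\mathcal{C}$ such that any sequence $(x_t)_{t\in\mathbb{N}}$ generated from $x_0$ by the Frank-Wolfe algorithm for minimizing $f$ over $\mathcal{C}$ using the line-search strategy does not converge.
   Context: $\mathbb{R}^n$ is equipped with the Euclidean inner product $\langle\cdot,\cdot\rangle$ and norm $\|\cdot\|$, and $\mathbb{N}=\{0,1,2,\ldots\}$. $\operatorname{int}\mathcal{C}$ is the interior of $\mathcal{C}$ in $\mathbb{R}^n$, and $\operatorname{arg\,min}_{\mathcal{C}}f$ is the set of minimizers of $f$ over $\mathcal{C}$. A sequence $(x_t)_{t\in\mathbb{N}}$ is generated by the Frank-Wolfe algorithm for minimizing $f$ over $\mathcal{C}$ from $x_0\in\mathcal{C}$ if for all $t\in\mathbb{N}$ there exist $v_t\in\operatorname{arg\,min}_{v\in\mathcal{C}}\langle v,\nabla f(x_t)\rangle$ and $\gamma_t\in[0,1]$ such that $x_{t+1}=(1-\gamma_t)x_t+\gamma_tv_t$. No restriction is made on which minimizer $v_t$ is selected: "any sequence" ranges over all possible choices of the $v_t$ and of the admissible $\gamma_t$. The algorithm uses the line-search strategy if $\gamma_t\in\operatorname{arg\,min}_{\gamma\in[0,1]}f(x_t+\gamma(v_t-x_t))$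 for all $t\in\mathbb{N}$. *)

theory Defs
  imports "HOL-Analysis.Analysis" "HOL-Library.Function_Algebras"
begin

text \<open>
  The dimension is existentially quantified in the statement, so it cannot be a type.
  The space of dimension \<open>n\<close> is the library's \<^term>\<open>Euclidean_space n\<close>: the functions
  \<open>x :: nat \<Rightarrow> real\<close> with \<open>x i = 0\<close> for all \<open>i \<ge> n\<close>.  Its topology is
  the subspace topology of the product topology, which for fixed \<open>n\<close> is the usual one.
  The pointwise vector space structure makes \<^const>\<open>convex\<close> and \<^const>\<open>convex_on\<close> available.
\<close>

instantiation "fun" :: (type, real_vector) real_vector
begin

definition scaleR_fun :: "real \<Rightarrow> ('a \<Rightarrow> 'b) \<Rightarrow> 'a \<Rightarrow> 'b"
  where "scaleR_fun c f = (\<lambda>i. c *\<^sub>R f i)"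

instance
  by standard
    (simp_all add: scaleR_fun_def plus_fun_def scaleR_add_right scaleR_add_left)

end

definition inner_n :: "nat \<Rightarrow> (nat \<Rightarrow> real) \<Rightarrow> (nat \<Rightarrow> real) \<Rightarrow> real"
  where "inner_n n x y = (\<Sum>i<n. x i * y i)"

definition norm_n :: "nat \<Rightarrow> (nat \<Rightarrow> real) \<Rightarrow> real"
  where "norm_n n x = sqrt (inner_n n x x)"

text \<open>Frechet differentiability at \<open>x\<close>; \<^const>\<open>atin\<close> is the punctured neighbourhood
  filter.  At a point of an open set \<open>D\<close> only the values of \<open>f\<close> on \<open>D\<close> matter, so a function on
  \<open>D\<close> is modelled by a total one.  The condition on the carrier makes \<open>g\<close> unique when it exists.\<close>

definition has_gradient ::
    "nat \<Rightarrow> ((nat \<Rightarrow> real) \<Rightarrow> real) \<Rightarrow> (nat \<Rightarrow> real) \<Rightarrow> (nat \<Rightarrow> real) \<Rightarrow> bool"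
  where "has_gradient n f x g \<longleftrightarrow>
    g \<in> topspace (Euclidean_space n) \<and>
    ((\<lambda>y. (f y - f x - inner_n n g (y - x)) / norm_n n (y - x)) \<longlongrightarrow> 0)
      (atin (Euclidean_space n) x)"

definition gradient ::
    "nat \<Rightarrow> ((nat \<Rightarrow> real) \<Rightarrow> real) \<Rightarrow> (nat \<Rightarrow> real) \<Rightarrow> (nat \<Rightarrow> real)"
  where "gradient n f x = (SOME g. has_gradient n f x g)"

definition lipschitz_gradient_on ::
    "nat \<Rightarrow> real \<Rightarrow> (nat \<Rightarrow> real) set \<Rightarrow> ((nat \<Rightarrow> real) \<Rightarrow> real) \<Rightarrow> bool"
  where "lipschitz_gradient_on n L D f \<longleftrightarrow>
    (\<forall>x\<in>D. \<exists>g. has_gradient n f x g) \<and>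
    (\<forall>x\<in>D. \<forall>y\<in>D. norm_n n (gradient n f x - gradient n f y) \<le> L * norm_n n (x - y))"

definition argmin_on :: "'a set \<Rightarrow> ('a \<Rightarrow> real) \<Rightarrow> 'a set"
  where "argmin_on S f = {x. is_arg_min f (\<lambda>y. y \<in> S) x}"

definition frank_wolfe ::
    "nat \<Rightarrow> ((nat \<Rightarrow> real) \<Rightarrow> real) \<Rightarrow> (nat \<Rightarrow> real) set \<Rightarrow>
      (nat \<Rightarrow> nat \<Rightarrow> real) \<Rightarrow> (nat \<Rightarrow> nat \<Rightarrow> real) \<Rightarrow> (nat \<Rightarrow> real) \<Rightarrow> bool"
  where "frank_wolfe n f C x v \<gamma> \<longleftrightarrow>
    x 0 \<in> C \<and>
    (\<forall>t. v t \<in> argmin_on C (\<lambda>w. inner_n n w (gradient n f (x t))) \<and>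
         \<gamma> t \<in> {0..1} \<and>
         x (Suc t) = (1 - \<gamma> t) *\<^sub>R x t + \<gamma> t *\<^sub>R v t)"

definition line_search ::
    "((nat \<Rightarrow> real) \<Rightarrow> real) \<Rightarrow>
      (nat \<Rightarrow> nat \<Rightarrow> real) \<Rightarrow> (nat \<Rightarrow> nat \<Rightarrow> real) \<Rightarrow> (nat \<Rightarrow> real) \<Rightarrow> bool"
  where "line_search f x v \<gamma> \<longleftrightarrow>
    (\<forall>t. \<gamma> t \<in> argmin_on {0..1} (\<lambda>c. f (x t + c *\<^sub>R (v t - x t))))"

end

theory Submission
  imports Defs
begin

text \<open>
  The example lives in the plane.  The objective function is the squared distance to the square \<open>Q\<close> with
  corners \<open>(\<plusminus>1, \<plusminus>1)\<close>, which is convex with a 2-Lipschitz gradient and has \<open>Q\<close> as its set of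
  minimizers.  The feasible set is a larger, tilted square around \<open>Q\<close> in pinwheel position: its vertices
  \<open>(-3, 1)\<close>, \<open>(-1, -3)\<close>, \<open>(3, -1)\<close>, \<open>(1, 3)\<close> lie on the lines that prolong the four sides of \<open>Q\<close>.

  Suppose that an iterate is \<open>(1 + u, 1 + w)\<close> with \<open>u\<close> and \<open>w\<close> positive, \<open>u\<close> at most \<open>1\<close>, and \<open>w\<close> less than
  half of \<open>u\<close>.  The gradient \<open>(2 u, 2 w)\<close> is so close to horizontal that the linear subproblem has the single solution
  \<open>(-3, 1)\<close> (\<open>linear_minimizer\<close>).  The segment to that vertex passes above the upper side of \<open>Q\<close>
  without meeting \<open>Q\<close>, and the objective function keeps decreasing along it until slightly after the corner
  \<open>(-1, 1)\<close>.  So line search stops at some \<open>(-1 - w', 1 + u')\<close> with \<open>u'\<close> and \<open>w'\<close> positive,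
  and the first-order condition \<open>w' (4 + u) = w u'\<close> (\<open>line_search_minimizer\<close>) shows that \<open>w'\<close> is
  again less than half of \<open>u'\<close>.  Up to a quarter turn, under which the whole problem is invariant
  (\<open>run_shift\<close>), the new iterate is in the same position as the old one (\<open>near_corner_step\<close>).

  Hence the iterates visit the neighbourhoods of the four corners of \<open>Q\<close> in cyclic order for ever and never
  enter \<open>Q\<close>.  Every two steps the first coordinate changes by more than \<open>2\<close>
  (\<open>coordinate_jumps\<close>), so the sequence has no limit.
\<close>

section \<open>Continuity and gradients in the Euclidean space of dimension n\<close>

lemma minus_fun_apply: "(x - y) i = x i - (y i :: real)" for x y :: "nat \<Rightarrow> real"
  by simp

lemma scaleR_fun_apply: "(c *\<^sub>R x) i = c * (x i :: real)" for x :: "nat \<Rightarrow> real"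
  by (simp add: scaleR_fun_def)

lemma continuous_map_coordinate:
  "continuous_map (Euclidean_space n) euclideanreal (\<lambda>y. y i)"
  unfolding Euclidean_space_def
  by (intro continuous_map_from_subtopology continuous_map_product_projection) simp

lemma continuous_map_norm_n_diff:
  "continuous_map (Euclidean_space n) euclideanreal (\<lambda>y. norm_n n (y - x))"
  unfolding norm_n_def inner_n_def minus_fun_apply
  by (intro continuous_intros continuous_map_coordinate) auto

lemma inner_n_nonneg: "0 \<le> inner_n n x x"
  unfolding inner_n_def by (intro sum_nonneg) simp

lemma inner_n_eq_0_iff: "inner_n n x x = 0 \<longleftrightarrow> (\<forall>i<n. x i = 0)"
  unfolding inner_n_def by (subst sum_nonneg_eq_0_iff) auto

text \<open>The quotient in the definition of the gradient is at most \<open>K\<close> times the norm of \<open>y - x\<close>.\<close>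

lemma has_gradientI:
  assumes x: "x \<in> topspace (Euclidean_space n)" and g: "g \<in> topspace (Euclidean_space n)"
    and err: "\<And>y. y \<in> topspace (Euclidean_space n) \<Longrightarrow>
      \<bar>f y - f x - inner_n n g (y - x)\<bar> \<le> K * (norm_n n (y - x))\<^sup>2"
  shows "has_gradient n f x g"
  unfolding has_gradient_def
proof
  let ?F = "atin (Euclidean_space n) x"
  let ?N = "\<lambda>y. norm_n n (y - x)"
  have "limitin euclideanreal ?N (?N x) ?F"
    using continuous_map_norm_n_diff x unfolding continuous_map_atin by blast
  then have "(?N \<longlongrightarrow> 0) ?F"
    by (simp add: norm_n_def inner_n_def)
  then have lim: "((\<lambda>y. K * ?N y) \<longlongrightarrow> 0) ?F"
    by (rule tendsto_mult_right_zero)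
  have "\<bar>(f y - f x - inner_n n g (y - x)) / ?N y\<bar> \<le> K * ?N y"
    if "y \<in> topspace (Euclidean_space n)" for y
  proof (cases "?N y = 0")
    case False
    then have "0 < ?N y"
      using inner_n_nonneg[of n "y - x"] by (simp add: norm_n_def)
    then show ?thesis
      using err[OF that] by (simp add: divide_le_eq power2_eq_square mult.assoc)
  qed simp
  then have "\<forall>\<^sub>F y in ?F. norm ((f y - f x - inner_n n g (y - x)) / ?N y) \<le> K * ?N y"
    unfolding eventually_atin real_norm_def
    by (intro disjI2 exI[of _ "topspace (Euclidean_space n)"]) (use x in auto)
  then show "((\<lambda>y. (f y - f x - inner_n n g (y - x)) / ?N y) \<longlongrightarrow> 0) ?F"
    using lim by (rule Lim_null_comparison)
qed (rule g)

text \<open>Two gradients \<open>g\<close> and \<open>h\<close> are compared along the ray from \<open>x\<close> in the direction \<open>h - g\<close>: there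
  the difference of the two error quotients is the constant norm of \<open>h - g\<close>, and it tends to zero.\<close>

lemma has_gradient_unique:
  assumes x: "x \<in> topspace (Euclidean_space n)"
    and g: "has_gradient n f x g" and h: "has_gradient n f x h"
  shows "g = h"
proof -
  let ?X = "Euclidean_space n"
  define d where "d = h - g"
  define Q where "Q k y = (f y - f x - inner_n n k (y - x)) / norm_n n (y - x)" for k y
  have top: "g \<in> topspace ?X" "h \<in> topspace ?X"
    and "(Q g \<longlongrightarrow> 0) (atin ?X x)" "(Q h \<longlongrightarrow> 0) (atin ?X x)"
    using g h unfolding has_gradient_def Q_def by auto
  then have lim: "((\<lambda>y. Q g y - Q h y) \<longlongrightarrow> 0) (atin ?X x)"
    using tendsto_diff by force
  have "inner_n n d d = 0"
  proof (rule ccontr)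
    assume "inner_n n d d \<noteq> 0"
    then have pos: "0 < inner_n n d d"
      using inner_n_nonneg[of n d] by linarith
    then have npos: "0 < norm_n n d" by (simp add: norm_n_def)
    have "\<forall>\<^sub>F y in atin ?X x. dist (Q g y - Q h y) 0 < norm_n n d"
      using lim npos by (rule tendstoD)
    then obtain U where U: "openin ?X U" "x \<in> U"
      and small: "\<And>y. y \<in> U \<Longrightarrow> y \<noteq> x \<Longrightarrow> \<bar>Q g y - Q h y\<bar> < norm_n n d"
      using x unfolding eventually_atin by auto
    let ?ray = "\<lambda>s::real. \<lambda>i. if i < n then x i + s * d i else 0"
    have ray: "?ray s = x + s *\<^sub>R d" for s
      using x top by (auto simp: fun_eq_iff d_def scaleR_fun_apply topspace_Euclidean_space)
    have "continuous_map euclideanreal ?X ?ray"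
      unfolding continuous_map_componentwise_Euclidean_space
      by (auto intro!: continuous_intros)
    then have "openin euclideanreal {s \<in> topspace euclideanreal. ?ray s \<in> U}"
      using U(1) by (rule openin_continuous_map_preimage)
    then have "open {s. x + s *\<^sub>R d \<in> U}"
      unfolding ray by simp
    moreover have "(0::real) \<in> {s. x + s *\<^sub>R d \<in> U}"
      using U(2) by simp
    ultimately obtain e where e: "0 < e" "ball 0 e \<subseteq> {s. x + s *\<^sub>R d \<in> U}"
      by (meson openE)
    define s where "s = e / 2"
    have s: "0 < s" "s \<in> ball 0 e"
      using e(1) by (auto simp: s_def)
    have inner_s: "inner_n n k (s *\<^sub>R d) = s * inner_n n k d" for k
      by (simp add: inner_n_def scaleR_fun_apply sum_distrib_left ac_simps)
    have norm_s: "norm_n n (s *\<^sub>R d) = s * norm_n n d"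
      using s(1) by (simp add: norm_n_def inner_n_def scaleR_fun_apply real_sqrt_mult
          power_mult_distrib flip: sum_distrib_left power2_eq_square)
    have "x + s *\<^sub>R d \<noteq> x"
      using norm_s s(1) npos by (auto simp: norm_n_def inner_n_def)
    then have "\<bar>Q g (x + s *\<^sub>R d) - Q h (x + s *\<^sub>R d)\<bar> < norm_n n d"
      using s(2) e(2) by (intro small) auto
    moreover have "Q g (x + s *\<^sub>R d) - Q h (x + s *\<^sub>R d)
        = (s * (inner_n n h d - inner_n n g d)) / (s * norm_n n d)"
      by (simp add: Q_def inner_s norm_s diff_divide_distrib right_diff_distrib)
    moreover have "inner_n n h d - inner_n n g d = (norm_n n d)\<^sup>2"
      using inner_n_nonneg[of n d]
      by (simp add: d_def norm_n_def inner_n_def left_diff_distrib sum_subtractf)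
    ultimately show False
      using s(1) npos by (simp add: power2_eq_square)
  qed
  then show "g = h"
    using top unfolding inner_n_eq_0_iff
    by (simp add: d_def topspace_Euclidean_space fun_eq_iff) (metis not_less)
qed

lemma gradient_eqI:
  assumes "x \<in> topspace (Euclidean_space n)" "has_gradient n f x g"
  shows "gradient n f x = g"
  unfolding gradient_def using assms has_gradient_unique by blast

lemma frank_wolfe_in:
  assumes "convex C" "frank_wolfe n f C x v \<gamma>"
  shows "x t \<in> C"
proof (induction t)
  case 0
  then show ?case using assms(2) by (simp add: frank_wolfe_def)
next
  case (Suc t)
  have "v t \<in> C" "0 \<le> \<gamma> t" "\<gamma> t \<le> 1"
    and "x (Suc t) = (1 - \<gamma> t) *\<^sub>R x t + \<gamma> t *\<^sub>R v t"
    using assms(2) by (auto simp: frank_wolfe_def argmin_on_def is_arg_min_def)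
  then show ?case
    using convexD_alt[OF assms(1) Suc] by metis
qed

section \<open>The objective function and the feasible set\<close>

text \<open>The residual of the projection onto the interval from \<open>-1\<close> to \<open>1\<close>; its square is the squared
  distance to that interval, and its double is the derivative of its square.\<close>

definition excess :: "real \<Rightarrow> real"
  where "excess s = s - max (- 1) (min 1 s)"

text \<open>This is the tangent line inequality of a convex function.  It rests on the variational inequality that
  characterizes the projection \<open>a - excess a\<close>: seen from there, no point of the interval lies on the same
  side as \<open>a\<close>.\<close>

lemma excess_power2_lower: "(excess b)\<^sup>2 \<ge> (excess a)\<^sup>2 + 2 * excess a * (b - a)"
proof -
  have *: "excess a * ((b - excess b) - (a - excess a)) \<le> 0"
    by (auto simp: excess_def max_def min_def mult_le_0_iff)
  have "(excess b)\<^sup>2 - ((excess a)\<^sup>2 + 2 * excess a * (b - a))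
      = (excess b - excess a)\<^sup>2 - 2 * (excess a * ((b - excess b) - (a - excess a)))"
    by (simp add: power2_eq_square algebra_simps)
  then show ?thesis
    using * zero_le_power2[of "excess b - excess a"] by linarith
qed

text \<open>The projection of \<open>b\<close> is at least as close to \<open>b\<close> as the projection of \<open>a\<close> is.\<close>

lemma excess_power2_upper: "(excess b)\<^sup>2 \<le> (excess a)\<^sup>2 + 2 * excess a * (b - a) + (b - a)\<^sup>2"
proof -
  define p q where "p = a - excess a" and "q = b - excess b"
  have "(b - q)\<^sup>2 \<le> (b - p)\<^sup>2"
    unfolding p_def q_def excess_def abs_le_square_iff[symmetric] by (auto simp: max_def min_def)
  moreover have "(b - p)\<^sup>2 = (a - p)\<^sup>2 + 2 * (a - p) * (b - a) + (b - a)\<^sup>2"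
    by (simp add: power2_eq_square algebra_simps)
  ultimately show ?thesis
    by (simp add: p_def q_def)
qed

lemma excess_lipschitz: "\<bar>excess a - excess b\<bar> \<le> \<bar>a - b\<bar>"
  by (auto simp: excess_def max_def min_def)

lemma excess_minus: "excess (- s) = - excess s"
  by (auto simp: excess_def max_def min_def)

definition obj :: "(nat \<Rightarrow> real) \<Rightarrow> real"
  where "obj x = (excess (x 0))\<^sup>2 + (excess (x 1))\<^sup>2"

definition obj_grad :: "(nat \<Rightarrow> real) \<Rightarrow> (nat \<Rightarrow> real)"
  where "obj_grad x = (\<lambda>i. if i < 2 then 2 * excess (x i) else 0)"

text \<open>The square with vertices \<open>(1, 3)\<close>, \<open>(-3, 1)\<close>, \<open>(-1, -3)\<close>, \<open>(3, -1)\<close>.\<close>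

definition feasible :: "(nat \<Rightarrow> real) set"
  where "feasible = {x \<in> topspace (Euclidean_space 2).
    \<bar>2 * x 0 + x 1\<bar> \<le> 5 \<and> \<bar>2 * x 1 - x 0\<bar> \<le> 5}"

lemma inner_2: "inner_n 2 x y = x 0 * y 0 + x 1 * y 1"
  by (simp add: inner_n_def numeral_2_eq_2)

lemma norm_2_power2: "(norm_n 2 x)\<^sup>2 = (x 0)\<^sup>2 + (x 1)\<^sup>2"
  by (simp add: norm_n_def inner_2 power2_eq_square)

lemma feasible_top: "feasible \<subseteq> topspace (Euclidean_space 2)"
  by (auto simp: feasible_def)

lemma convex_topspace: "convex (topspace (Euclidean_space n))"
  unfolding convex_def by (auto simp: topspace_Euclidean_space scaleR_fun_apply)

lemma obj_lower: "obj y \<ge> obj x + inner_n 2 (obj_grad x) (y - x)"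
  using excess_power2_lower[of "x 0" "y 0"] excess_power2_lower[of "x 1" "y 1"]
  by (simp add: obj_def obj_grad_def inner_2)

lemma obj_upper: "obj y \<le> obj x + inner_n 2 (obj_grad x) (y - x) + (norm_n 2 (y - x))\<^sup>2"
  using excess_power2_upper[of "y 0" "x 0"] excess_power2_upper[of "y 1" "x 1"]
  by (simp add: obj_def obj_grad_def inner_2 norm_2_power2)

lemma gradient_obj:
  assumes "x \<in> topspace (Euclidean_space 2)"
  shows "has_gradient 2 obj x (obj_grad x)" "gradient 2 obj x = obj_grad x"
proof -
  show *: "has_gradient 2 obj x (obj_grad x)"
  proof (rule has_gradientI[where K = 1])
    show "obj_grad x \<in> topspace (Euclidean_space 2)"
      by (auto simp: obj_grad_def topspace_Euclidean_space)
    show "\<bar>obj y - obj x - inner_n 2 (obj_grad x) (y - x)\<bar> \<le> 1 * (norm_n 2 (y - x))\<^sup>2" for y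
      using obj_lower[of x y] obj_upper[of y x] by linarith
  qed (rule assms)
  show "gradient 2 obj x = obj_grad x"
    using assms * by (rule gradient_eqI)
qed

lemma obj_lipschitz_gradient: "lipschitz_gradient_on 2 2 (topspace (Euclidean_space 2)) obj"
  unfolding lipschitz_gradient_on_def
proof (intro conjI ballI)
  fix x y :: "nat \<Rightarrow> real"
  assume "x \<in> topspace (Euclidean_space 2)" "y \<in> topspace (Euclidean_space 2)"
  have sq: "(2 * excess (x i) - 2 * excess (y i))\<^sup>2 \<le> 4 * (x i - y i)\<^sup>2" for i
  proof -
    have "(2 * excess (x i) - 2 * excess (y i))\<^sup>2 = 4 * (excess (x i) - excess (y i))\<^sup>2"
      by (simp add: power2_eq_square algebra_simps)
    moreover have "(excess (x i) - excess (y i))\<^sup>2 \<le> (x i - y i)\<^sup>2"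
      using excess_lipschitz unfolding abs_le_square_iff .
    ultimately show ?thesis by linarith
  qed
  have "(norm_n 2 (obj_grad x - obj_grad y))\<^sup>2 \<le> (2 * norm_n 2 (x - y))\<^sup>2"
    using sq[of 0] sq[of 1]
    by (simp add: norm_2_power2 obj_grad_def power_mult_distrib)
  then have "norm_n 2 (obj_grad x - obj_grad y) \<le> 2 * norm_n 2 (x - y)"
    by (rule power2_le_imp_le) (simp add: norm_n_def inner_n_nonneg)
  then show "norm_n 2 (gradient 2 obj x - gradient 2 obj y) \<le> 2 * norm_n 2 (x - y)"
    using gradient_obj(2) \<open>x \<in> _\<close> \<open>y \<in> _\<close> by simp
qed (use gradient_obj in blast)

text \<open>The tangent plane at the intermediate point \<open>z\<close> lies below the function at both ends.\<close>

lemma convex_on_obj: "convex_on (topspace (Euclidean_space 2)) obj"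
proof (rule convex_onI)
  fix t :: real and x y :: "nat \<Rightarrow> real"
  assume t: "0 < t" "t < 1"
  define z where "z = (1 - t) *\<^sub>R x + t *\<^sub>R y"
  have "inner_n 2 (obj_grad z) (x - z) * (1 - t) + inner_n 2 (obj_grad z) (y - z) * t = 0"
    by (simp add: inner_2 z_def scaleR_fun_apply algebra_simps)
  moreover have "(1 - t) * obj x \<ge> (1 - t) * (obj z + inner_n 2 (obj_grad z) (x - z))"
    using t obj_lower by (intro mult_left_mono) auto
  moreover have "t * obj y \<ge> t * (obj z + inner_n 2 (obj_grad z) (y - z))"
    using t obj_lower by (intro mult_left_mono) auto
  ultimately show "obj z \<le> (1 - t) * obj x + t * obj y"
    by (simp add: algebra_simps)
qed (rule convex_topspace)

lemma convex_feasible: "convex feasible"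
proof -
  have "convex {x :: nat \<Rightarrow> real. \<bar>2 * x 0 + x 1\<bar> \<le> 5 \<and> \<bar>2 * x 1 - x 0\<bar> \<le> 5}"
    (is "convex ?S")
    unfolding convex_def
  proof (intro ballI allI impI)
    fix x y :: "nat \<Rightarrow> real" and a b :: real
    assume xy: "x \<in> ?S" "y \<in> ?S" and ab: "0 \<le> a" "0 \<le> b" "a + b = 1"
    have *: "\<bar>a * r + b * s\<bar> \<le> 5" if "\<bar>r\<bar> \<le> 5" "\<bar>s\<bar> \<le> 5" for r s :: real
      using convex_bound_le[of r 5 s a b] convex_bound_le[of "- r" 5 "- s" a b] that ab
      by (simp add: abs_le_iff)
    show "a *\<^sub>R x + b *\<^sub>R y \<in> ?S"
      using *[of "2 * x 0 + x 1" "2 * y 0 + y 1"] *[of "2 * x 1 - x 0" "2 * y 1 - y 0"] xy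
      by (simp add: scaleR_fun_apply algebra_simps)
  qed
  then have "convex (topspace (Euclidean_space 2) \<inter> ?S)"
    by (intro convex_Int convex_topspace)
  then show ?thesis
    by (simp add: feasible_def Collect_conj_eq)
qed

text \<open>A closed subset of a product of compact intervals, degenerate from coordinate \<open>2\<close> on.\<close>

lemma compactin_feasible: "compactin (Euclidean_space 2) feasible"
proof -
  let ?B = "\<Pi>\<^sub>E i\<in>UNIV. if i < 2 then {- 3..3::real} else {0}"
  have cont: "continuous_map (powertop_real UNIV) euclideanreal (\<lambda>x. x i)" for i :: nat
    by (rule continuous_map_product_projection) simp
  have "compactin (powertop_real UNIV) ?B"
    by (subst compactin_PiE) auto
  moreover have "feasible \<subseteq> ?B"
    by (auto simp: feasible_def topspace_Euclidean_space PiE_iff less_2_cases_iff)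
  moreover have "closedin (powertop_real UNIV) feasible"
  proof -
    have "feasible = topspace (Euclidean_space 2)
        \<inter> {x \<in> topspace (powertop_real UNIV). 2 * x 0 + x 1 \<in> {- 5..5}}
        \<inter> {x \<in> topspace (powertop_real UNIV). 2 * x 1 - x 0 \<in> {- 5..5}}"
      by (auto simp: feasible_def)
    also have "closedin (powertop_real UNIV) \<dots>"
      by (intro closedin_Int closedin_Euclidean_space closedin_continuous_map_preimage)
        (auto intro!: continuous_intros cont)
    finally show ?thesis .
  qed
  ultimately have "compactin (powertop_real UNIV) feasible"
    by (rule closed_compactin)
  then show ?thesis
    using feasible_top by (simp add: Euclidean_space_def compactin_subtopology)
qed

lemma argmin_obj_interior: "argmin_on feasible obj \<subseteq> (Euclidean_space 2) interior_of feasible"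
proof
  fix x assume "x \<in> argmin_on feasible obj"
  then have x: "x \<in> feasible" "\<And>y. y \<in> feasible \<Longrightarrow> obj x \<le> obj y"
    by (auto simp: argmin_on_def is_arg_min_def not_less)
  have "obj x \<le> obj (\<lambda>_. 0)"
    by (intro x) (simp add: feasible_def topspace_Euclidean_space)
  then have "excess (x 0) = 0" "excess (x 1) = 0"
    by (auto simp: obj_def excess_def[of 0] sum_power2_le_zero_iff)
  then have "\<bar>x 0\<bar> \<le> 1" "\<bar>x 1\<bar> \<le> 1"
    by (auto simp: excess_def)
  define U where "U = {x \<in> topspace (Euclidean_space 2). 2 * x 0 + x 1 \<in> {- 5<..<5}}
        \<inter> {x \<in> topspace (Euclidean_space 2). 2 * x 1 - x 0 \<in> {- 5<..<5}}"
  have "openin (Euclidean_space 2) U"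
    unfolding U_def
    by (intro openin_Int openin_continuous_map_preimage)
      (auto intro!: continuous_intros continuous_map_coordinate)
  moreover have "U \<subseteq> feasible"
    by (auto simp: U_def feasible_def)
  moreover have "x \<in> U"
    using \<open>\<bar>x 0\<bar> \<le> 1\<close> \<open>\<bar>x 1\<bar> \<le> 1\<close> x(1) by (auto simp: U_def feasible_def)
  ultimately show "x \<in> (Euclidean_space 2) interior_of feasible"
    unfolding interior_of_def by blast
qed

section \<open>One step of the algorithm\<close>

text \<open>The two offsets \<open>x 0 - 1\<close> and \<open>x 1 - 1\<close> are the \<open>u\<close> and \<open>w\<close> of the introduction.  The upper
  bound on \<open>u\<close> makes \<open>w\<close> less than one half, which keeps the ratio of the offsets small in the next step.\<close>

definition near_corner :: "(nat \<Rightarrow> real) \<Rightarrow> bool"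
  where "near_corner x \<longleftrightarrow> 1 < x 1 \<and> 2 * (x 1 - 1) < x 0 - 1 \<and> x 0 \<le> 2"

text \<open>The clockwise rotation.  It takes the corner \<open>(-1, 1)\<close>, which the iterates reach after
  \<open>(1, 1)\<close>, back to \<open>(1, 1)\<close>.\<close>

definition quarter_turn :: "(nat \<Rightarrow> real) \<Rightarrow> (nat \<Rightarrow> real)"
  where "quarter_turn x = x(0 := x 1, 1 := - x 0)"

definition run :: "(nat \<Rightarrow> nat \<Rightarrow> real) \<Rightarrow> (nat \<Rightarrow> nat \<Rightarrow> real) \<Rightarrow> (nat \<Rightarrow> real) \<Rightarrow> bool"
  where "run x v \<gamma> \<longleftrightarrow> frank_wolfe 2 obj feasible x v \<gamma> \<and> line_search obj x v \<gamma>"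

lemma quarter_turn_coords [simp]:
  "quarter_turn x 0 = x 1" "quarter_turn x (Suc 0) = - x 0"
  by (auto simp: quarter_turn_def)

lemma quarter_turn_linear:
  "quarter_turn (a *\<^sub>R x + b *\<^sub>R y) = a *\<^sub>R quarter_turn x + b *\<^sub>R quarter_turn y"
  "quarter_turn (x + a *\<^sub>R (y - x)) = quarter_turn x + a *\<^sub>R (quarter_turn y - quarter_turn x)"
  by (simp_all add: quarter_turn_def scaleR_fun_apply fun_eq_iff right_diff_distrib)

lemma quarter_turn_feasible: "quarter_turn x \<in> feasible \<longleftrightarrow> x \<in> feasible"
  by (auto simp: feasible_def topspace_Euclidean_space quarter_turn_def)

lemma surj_quarter_turn: "\<exists>y. x = quarter_turn y"
  by (rule exI[of _ "x(0 := - x 1, 1 := x 0)"]) (auto simp: quarter_turn_def fun_eq_iff)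

lemma obj_quarter_turn: "obj (quarter_turn x) = obj x"
  by (simp add: obj_def excess_minus)

lemma inner_quarter_turn:
  "inner_n 2 (quarter_turn x) (obj_grad (quarter_turn y)) = inner_n 2 x (obj_grad y)"
  by (simp add: inner_2 obj_grad_def excess_minus)

text \<open>Both the objective function and the feasible set are invariant under the quarter turn, so every
  statement about the first step applies to all later steps.\<close>

lemma run_shift:
  assumes "run x v \<gamma>"
  shows "run (\<lambda>t. quarter_turn (x (Suc t))) (\<lambda>t. quarter_turn (v (Suc t))) (\<lambda>t. \<gamma> (Suc t))"
proof -
  have fw: "frank_wolfe 2 obj feasible x v \<gamma>" and ls: "line_search obj x v \<gamma>"
    using assms by (auto simp: run_def)
  have x: "x t \<in> feasible" for t
    using convex_feasible fw by (rule frank_wolfe_in)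
  then have top: "x t \<in> topspace (Euclidean_space 2)"
      "quarter_turn (x t) \<in> topspace (Euclidean_space 2)" for t
    using feasible_top quarter_turn_feasible by blast+
  have lmo: "quarter_turn (v t) \<in> argmin_on feasible
      (\<lambda>w. inner_n 2 w (gradient 2 obj (quarter_turn (x t))))" for t
  proof -
    have "v t \<in> argmin_on feasible (\<lambda>w. inner_n 2 w (gradient 2 obj (x t)))"
      using fw by (simp add: frank_wolfe_def)
    then have v: "v t \<in> feasible"
        "\<And>w. w \<in> feasible \<Longrightarrow> inner_n 2 (v t) (obj_grad (x t)) \<le> inner_n 2 w (obj_grad (x t))"
      by (auto simp: argmin_on_def is_arg_min_def not_less gradient_obj(2)[OF top(1)])
    have "inner_n 2 (v t) (obj_grad (x t)) \<le> inner_n 2 w (obj_grad (quarter_turn (x t)))"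
      if "w \<in> feasible" for w
      using that v(2) surj_quarter_turn[of w] quarter_turn_feasible inner_quarter_turn by metis
    then show ?thesis
      using v(1)
      by (auto simp: argmin_on_def is_arg_min_def not_less gradient_obj(2)[OF top(2)]
          quarter_turn_feasible inner_quarter_turn)
  qed
  show ?thesis
    unfolding run_def frank_wolfe_def line_search_def
  proof (intro conjI allI)
    fix t
    show "quarter_turn (x (Suc 0)) \<in> feasible"
      by (simp add: quarter_turn_feasible x)
    show "quarter_turn (v (Suc t)) \<in> argmin_on feasible
        (\<lambda>w. inner_n 2 w (gradient 2 obj (quarter_turn (x (Suc t)))))"
      by (rule lmo)
    show "\<gamma> (Suc t) \<in> {0..1}"
      using fw unfolding frank_wolfe_def by blast
    have "x (Suc (Suc t)) = (1 - \<gamma> (Suc t)) *\<^sub>R x (Suc t) + \<gamma> (Suc t) *\<^sub>R v (Suc t)"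
      using fw unfolding frank_wolfe_def by blast
    then show "quarter_turn (x (Suc (Suc t)))
        = (1 - \<gamma> (Suc t)) *\<^sub>R quarter_turn (x (Suc t)) + \<gamma> (Suc t) *\<^sub>R quarter_turn (v (Suc t))"
      by (simp only: quarter_turn_linear)
    show "\<gamma> (Suc t) \<in> argmin_on {0..1} (\<lambda>c. obj (quarter_turn (x (Suc t))
        + c *\<^sub>R (quarter_turn (v (Suc t)) - quarter_turn (x (Suc t)))))"
      using ls unfolding line_search_def quarter_turn_linear(2)[symmetric] obj_quarter_turn by blast
  qed
qed

text \<open>In the coordinates \<open>2 * v 0 + v 1\<close> and \<open>2 * v 1 - v 0\<close> the feasible set is an axis-parallel square, so
  that the two coordinates can be minimized separately; \<open>a\<close> and \<open>b\<close> below are their distances from the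
  optimal values \<open>- 5\<close> and \<open>5\<close>.\<close>

lemma linear_minimizer:
  assumes v: "v \<in> argmin_on feasible (\<lambda>w. inner_n 2 w g)"
    and g: "0 < 2 * g 0 + g 1" "2 * g 1 < g 0"
  shows "v 0 = - 3" "v 1 = 1"
proof -
  define w :: "nat \<Rightarrow> real" where "w = (\<lambda>i. if i = 0 then - 3 else if i = 1 then 1 else 0)"
  have "w \<in> feasible"
    by (auto simp: w_def feasible_def topspace_Euclidean_space)
  then have "inner_n 2 v g \<le> inner_n 2 w g" and vf: "v \<in> feasible"
    using v by (auto simp: argmin_on_def is_arg_min_def not_less)
  define a b where "a = 2 * v 0 + v 1 + 5" and "b = 5 - (2 * v 1 - v 0)"
  have ab: "0 \<le> a" "0 \<le> b"
    using vf by (auto simp: a_def b_def feasible_def abs_le_iff)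
  have "a * (2 * g 0 + g 1) + b * (g 0 - 2 * g 1) = 5 * (inner_n 2 v g - inner_n 2 w g)"
    by (simp add: a_def b_def w_def inner_2 algebra_simps)
  then have "a * (2 * g 0 + g 1) + b * (g 0 - 2 * g 1) \<le> 0"
    using \<open>inner_n 2 v g \<le> inner_n 2 w g\<close> by simp
  moreover have "0 \<le> a * (2 * g 0 + g 1)" "0 \<le> b * (g 0 - 2 * g 1)"
    using ab g by auto
  ultimately have "a * (2 * g 0 + g 1) = 0" "b * (g 0 - 2 * g 1) = 0"
    by linarith+
  then have "a = 0" "b = 0"
    using g by auto
  then show "v 0 = - 3" "v 1 = 1"
    by (auto simp: a_def b_def)
qed

text \<open>The function minimized here is the objective function on the segment from \<open>(1 + u, 1 + w)\<close> to
  \<open>(-3, 1)\<close>, and the conclusion is the condition that its derivative vanishes at \<open>c\<close>, in the branch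
  beyond the corner \<open>(-1, 1)\<close>.  The solution \<open>s\<close> of that linear equation lies strictly between \<open>0\<close> and
  \<open>1\<close>.  The tangent line inequality at \<open>s\<close> for the first summand and the exact expansion of the second
  show that the value at any \<open>c\<close> exceeds the value at \<open>s\<close> by at least \<open>(w * (c - s))\<^sup>2\<close>, so that no
  other minimizer exists.\<close>

lemma line_search_minimizer:
  fixes u w c :: real
  assumes u: "0 < u" and w: "0 < w"
    and c: "c \<in> {0..1}"
    and min: "\<And>b. b \<in> {0..1} \<Longrightarrow>
      (excess (1 + u - c * (4 + u)))\<^sup>2 + (w * (1 - c))\<^sup>2
      \<le> (excess (1 + u - b * (4 + u)))\<^sup>2 + (w * (1 - b))\<^sup>2"
  shows "(c * (4 + u) - 2 - u) * (4 + u) = w\<^sup>2 * (1 - c)"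
proof -
  define s where "s = ((2 + u) * (4 + u) + w\<^sup>2) / ((4 + u)\<^sup>2 + w\<^sup>2)"
  define r where "r = s * (4 + u) - 2 - u"
  have pos: "0 < (4 + u)\<^sup>2 + w\<^sup>2"
    using w by (simp add: add_nonneg_pos)
  have "s * ((4 + u)\<^sup>2 + w\<^sup>2) = (2 + u) * (4 + u) + w\<^sup>2"
    using pos by (simp add: s_def)
  then have s_eq: "r * (4 + u) = w\<^sup>2 * (1 - s)"
    unfolding r_def by (simp add: power2_eq_square algebra_simps)
  have s: "0 < s" "s < 1"
    using pos u w by (auto simp: s_def power2_eq_square algebra_simps add_pos_pos)
  then have "0 < r * (4 + u)"
    unfolding s_eq using w by simp
  then have r: "0 < r"
    using u by (simp add: zero_less_mult_iff)
  have ex: "excess (1 + u - s * (4 + u)) = - r"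
    using r by (auto simp: excess_def r_def)
  have "(excess (1 + u - c * (4 + u)))\<^sup>2 \<ge> r\<^sup>2 + 2 * (r * (4 + u)) * (c - s)"
    using excess_power2_lower[of "1 + u - s * (4 + u)" "1 + u - c * (4 + u)"]
    unfolding ex by (simp add: algebra_simps)
  moreover have "(w * (1 - c))\<^sup>2
      = (w * (1 - s))\<^sup>2 - 2 * (w\<^sup>2 * (1 - s)) * (c - s) + (w * (c - s))\<^sup>2"
    by (simp add: power2_eq_square algebra_simps)
  moreover have "(excess (1 + u - c * (4 + u)))\<^sup>2 + (w * (1 - c))\<^sup>2 \<le> r\<^sup>2 + (w * (1 - s))\<^sup>2"
    using min[of s] s unfolding ex by simp
  ultimately have "(w * (c - s))\<^sup>2 \<le> 0"
    unfolding s_eq by linarith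
  then have "c = s"
    using w by simp
  then show ?thesis
    using s_eq by (simp add: r_def)
qed

text \<open>The next iterate is \<open>(-1 - w', 1 + u')\<close>, where \<open>w' (4 + u) = w u'\<close>.  As \<open>w\<close> is less than one half,
  the offset \<open>w'\<close> is less than an eighth of \<open>u'\<close>.\<close>

lemma near_corner_step:
  assumes run: "run x v \<gamma>" and x: "near_corner (x 0)"
  shows "near_corner (quarter_turn (x 1))"
proof -
  define u w c where "u = x 0 0 - 1" and "w = x 0 1 - 1" and "c = \<gamma> 0"
  have uw: "0 < w" "2 * w < u" "u \<le> 1"
    using x by (auto simp: near_corner_def u_def w_def)
  have fw: "frank_wolfe 2 obj feasible x v \<gamma>" and ls: "line_search obj x v \<gamma>"
    using run by (auto simp: run_def)
  have "x 0 \<in> topspace (Euclidean_space 2)"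
    using frank_wolfe_in[OF convex_feasible fw] feasible_top by blast
  then have "v 0 \<in> argmin_on feasible (\<lambda>y. inner_n 2 y (obj_grad (x 0)))"
    using fw by (simp add: frank_wolfe_def flip: gradient_obj(2))
  moreover have "obj_grad (x 0) 0 = 2 * u" "obj_grad (x 0) 1 = 2 * w"
    using uw by (auto simp: obj_grad_def excess_def u_def w_def)
  ultimately have v: "v 0 0 = - 3" "v 0 1 = 1"
    using linear_minimizer[of "v 0" "obj_grad (x 0)"] uw by auto
  have pt: "(x 0 + b *\<^sub>R (v 0 - x 0)) 0 = 1 + u - b * (4 + u)"
      "(x 0 + b *\<^sub>R (v 0 - x 0)) 1 = 1 + w * (1 - b)" for b
    using v by (auto simp: scaleR_fun_apply u_def w_def algebra_simps)
  have val: "obj (x 0 + b *\<^sub>R (v 0 - x 0)) = (excess (1 + u - b * (4 + u)))\<^sup>2 + (w * (1 - b))\<^sup>2"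
    if "b \<in> {0..1}" for b
  proof -
    have "0 \<le> w * (1 - b)"
      using that uw by simp
    then have "excess (1 + w * (1 - b)) = w * (1 - b)"
      by (simp add: excess_def)
    then show ?thesis
      unfolding obj_def pt by simp
  qed
  have c: "c \<in> {0..1}"
    and cmin: "\<And>b. b \<in> {0..1} \<Longrightarrow> obj (x 0 + c *\<^sub>R (v 0 - x 0)) \<le> obj (x 0 + b *\<^sub>R (v 0 - x 0))"
    using ls unfolding line_search_def c_def argmin_on_def is_arg_min_def
    by (auto simp: not_less)
  have eq: "(c * (4 + u) - 2 - u) * (4 + u) = w\<^sup>2 * (1 - c)"
    using uw c cmin by (intro line_search_minimizer) (auto simp: val)
  define u' w' where "u' = w * (1 - c)" and "w' = c * (4 + u) - 2 - u"
  have eq': "w' * (4 + u) = w * u'"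
    using eq by (simp add: u'_def w'_def power2_eq_square)
  have "c \<noteq> 1"
    using eq uw by auto
  then have "c < 1" using c by simp
  then have u': "0 < u'" "u' \<le> 1"
    using uw c mult_mono[of w 1 "1 - c" 1] by (auto simp: u'_def)
  have "0 < w' * (4 + u)"
    using u' uw by (simp add: eq')
  then have w': "0 < w'"
    using uw by (simp add: zero_less_mult_iff)
  have "4 * w' \<le> w' * (4 + u)"
    using w' uw by simp
  also have "\<dots> < 2 * u'"
    unfolding eq' using u' uw by simp
  finally have "2 * w' < u'" by simp
  moreover have "x 1 = x 0 + c *\<^sub>R (v 0 - x 0)"
    using fw by (auto simp: frank_wolfe_def c_def fun_eq_iff scaleR_fun_apply algebra_simps)
  then have "x 1 0 = - 1 - w'" "x 1 1 = 1 + u'"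
    using pt[of c] by (auto simp: w'_def u'_def)
  ultimately show ?thesis
    using u' w' by (simp add: near_corner_def)
qed

text \<open>Two quarter turns negate the first coordinate, and in the turned frame it is larger than \<open>1\<close> at every time.\<close>

lemma coordinate_jumps:
  assumes "run x v \<gamma>" "near_corner (x 0)"
  shows "2 < \<bar>x (2 * k) 0 - x (2 * k + 2) 0\<bar>"
  using assms
proof (induction k arbitrary: x v \<gamma>)
  case (0 x v \<gamma>)
  have "near_corner (quarter_turn (quarter_turn (x 2)))"
    using near_corner_step[OF run_shift[OF 0(1)]] near_corner_step[OF 0]
    by (simp add: numeral_2_eq_2)
  then have "1 < - x 2 0" "1 < x 0 0"
    using 0(2) by (auto simp: near_corner_def)
  then show ?case by (simp add: numeral_2_eq_2)
next
  case (Suc k x v \<gamma>)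
  let ?y = "\<lambda>t. quarter_turn (quarter_turn (x (Suc (Suc t))))"
  have "run ?y (\<lambda>t. quarter_turn (quarter_turn (v (Suc (Suc t))))) (\<lambda>t. \<gamma> (Suc (Suc t)))"
    using run_shift[OF run_shift[OF Suc.prems(1)]] .
  moreover have "near_corner (?y 0)"
    using near_corner_step[OF run_shift[OF Suc.prems(1)]] near_corner_step[OF Suc.prems] by simp
  ultimately have "2 < \<bar>?y (2 * k) 0 - ?y (2 * k + 2) 0\<bar>"
    by (rule Suc.IH)
  then show ?case by simp
qed

lemma run_not_convergent:
  assumes "run x v \<gamma>" "near_corner (x 0)"
  shows "\<not> limitin (Euclidean_space 2) x l sequentially"
proof
  assume "limitin (Euclidean_space 2) x l sequentially"
  then have "limitin euclideanreal ((\<lambda>y. y 0) \<circ> x) (l 0) sequentially"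
    by (rule continuous_map_limit[OF continuous_map_coordinate])
  then have "Cauchy (\<lambda>t. x t 0)"
    by (intro LIMSEQ_imp_Cauchy) (simp add: o_def)
  then obtain N where "\<forall>m\<ge>N. \<forall>n\<ge>N. dist (x m 0) (x n 0) < 2"
    unfolding Cauchy_def by (metis zero_less_numeral)
  then have "\<bar>x (2 * N) 0 - x (2 * N + 2) 0\<bar> < 2"
    unfolding dist_real_def by simp
  then show False
    using coordinate_jumps[OF assms, of N] by simp
qed

theorem mainTheorem2:
  shows "\<exists>(n::nat) (L::real) (C :: (nat \<Rightarrow> real) set) (D :: (nat \<Rightarrow> real) set)
           (f :: (nat \<Rightarrow> real) \<Rightarrow> real) (x0 :: nat \<Rightarrow> real).
    L > 0 \<and>
    C \<noteq> {} \<and> compactin (Euclidean_space n) C \<and> convex C \<and>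
    openin (Euclidean_space n) D \<and> convex D \<and> C \<subseteq> D \<and>
    convex_on D f \<and> lipschitz_gradient_on n L D f \<and>
    argmin_on C f \<subseteq> (Euclidean_space n) interior_of C \<and>
    x0 \<in> C \<and>
    (\<forall>x v \<gamma>. x 0 = x0 \<and> frank_wolfe n f C x v \<gamma> \<and> line_search f x v \<gamma> \<longrightarrow>
       \<not> (\<exists>l. limitin (Euclidean_space n) x l sequentially))"
proof -
  define x0 :: "nat \<Rightarrow> real"
    where "x0 = (\<lambda>i. if i = 0 then 3 / 2 else if i = 1 then 9 / 8 else 0)"
  have x0: "x0 \<in> feasible" "near_corner x0"
    by (auto simp: x0_def feasible_def topspace_Euclidean_space near_corner_def)
  have "\<not> (\<exists>l. limitin (Euclidean_space 2) x l sequentially)"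
    if "x 0 = x0 \<and> frank_wolfe 2 obj feasible x v \<gamma> \<and> line_search obj x v \<gamma>" for x v \<gamma>
    using that x0(2) run_not_convergent[of x v \<gamma>] by (auto simp: run_def)
  then show ?thesis
    using x0(1) compactin_feasible convex_feasible convex_topspace feasible_top convex_on_obj
      obj_lipschitz_gradient argmin_obj_interior
    by (intro exI[of _ "2::nat"] exI[of _ "2::real"] exI[of _ feasible]
        exI[of _ "topspace (Euclidean_space 2)"] exI[of _ obj] exI[of _ x0]) auto
qed

end
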